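(* Let $\Phi_k(\mathbf{A})$ be a symmetric positive definite matrix and let $\tau_k\ge 0$. Then the scalar $$\alpha_k^{RBB}=\frac{\mathbf{s}_{k-1}^{\mathrm{T}}\mathbf{y}_{k-1}+\tau_k\,\mathbf{s}_{k-1}^{\mathrm{T}}\Phi_k(\mathbf{A})^{\mathrm{T}}\Phi_k(\mathbf{A})\mathbf{y}_{k-1}}{\mathbf{s}_{k-1}^{\mathrm{T}}\mathbf{s}_{k-1}+\tau_k\,\mathbf{s}_{k-1}^{\mathrm{T}}\Phi_k(\mathbf{A})^{\mathrm{T}}\Phi_k(\mathbf{A})\mathbf{s}_{k-1}}$$ is the unique solution to the problem $$\min_{\alpha>0}\Big\{\|\alpha\mathbf{s}_{k-1}-\mathbf{y}_{k-1}\|_2^2+\tau_k\|\alpha\Phi_k(\mathbf{A})\mathbf{s}_{k-1}-\Phi_k(\mathbf{A})\mathbf{y}_{k-1}\|_2^2\Big\}.$$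
   Context: The setting is gradient descent $\mathbf{x}_{k+1}=\mathbf{x}_k-\frac{1}{\alpha_k}\mathbf{g}_k$ applied to the quadratic function $f(\mathbf{x})=\frac12(\mathbf{x}-\mathbf{x}_* )^{\mathrm{T}}\mathbf{A}(\mathbf{x}-\mathbf{x}_* )$ on $\mathbb{R}^n$, where $\mathbf{A}\in\mathbb{R}^{n\times n}$ is symmetric positive definite (without loss of generality taken to be diagonal, $\mathbf{A}=\mathrm{diag}\{\lambda_1,\ldots,\lambda_n\}$ with $0<\lambda_1\le\cdots\le\lambda_n$). Here $\mathbf{g}_k=\nabla f(\mathbf{x}_k)$, $\mathbf{s}_{k-1}=\mathbf{x}_k-\mathbf{x}_{k-1}$ and $\mathbf{y}_{k-1}=\mathbf{g}_k-\mathbf{g}_{k-1}$, so that $\mathbf{y}_{k-1}=\mathbf{A}\mathbf{s}_{k-1}$. $\Phi_k(\mathbf{A})$ denotes an $n\times n$ matrix, about which the only assumption made is that it is symmetric positive definite; the choices considered afterwards are $\Phi_k(\mathbf{A})=\sqrt{\mathbf{A}}$ and $\Phi_k(\mathbf{A})=\mathbf{A}$. The scalar $\tau_k$ is called the regularization parameter, and $\|\cdot\|_2$ is the Euclidean norm.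
   Formalization: For general symmetric positive definite Φ_k(A), α_k^RBB can be negative and then no minimiser exists; proved instead (for s_{k-1} ≠ 0): α is a solution iff α = α_k^RBB and α_k^RBB > 0, and α_k^RBB is the unique solution whenever Φ_k(A) commutes with A. *)

theory Defs
  imports "HOL-Analysis.Analysis"
begin

definition sym_pos_def :: "real ^ 'n ^ 'n \<Rightarrow> bool" where
  "sym_pos_def M \<longleftrightarrow> transpose M = M \<and> (\<forall>v. v \<noteq> 0 \<longrightarrow> v \<bullet> (M *v v) > 0)"

definition quad_fun :: "real ^ 'n ^ 'n \<Rightarrow> real ^ 'n \<Rightarrow> real ^ 'n \<Rightarrow> real" where
  "quad_fun A xs x = (1 / 2) * ((x - xs) \<bullet> (A *v (x - xs)))"

definition alpha_RBB :: "real ^ 'n \<Rightarrow> real ^ 'n \<Rightarrow> real \<Rightarrow> real ^ 'n ^ 'n \<Rightarrow> real" where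
  "alpha_RBB s y t P =
    (s \<bullet> y + t * (s \<bullet> ((transpose P ** P) *v y))) /
    (s \<bullet> s + t * (s \<bullet> ((transpose P ** P) *v s)))"

definition RBB_objective ::
    "real ^ 'n \<Rightarrow> real ^ 'n \<Rightarrow> real \<Rightarrow> real ^ 'n ^ 'n \<Rightarrow> real \<Rightarrow> real" where
  "RBB_objective s y t P a =
    (norm (a *\<^sub>R s - y))\<^sup>2 + t * (norm (a *\<^sub>R (P *v s) - P *v y))\<^sup>2"

definition RBB_solution ::
    "real ^ 'n \<Rightarrow> real ^ 'n \<Rightarrow> real \<Rightarrow> real ^ 'n ^ 'n \<Rightarrow> real \<Rightarrow> bool" where
  "RBB_solution s y t P = is_arg_min (RBB_objective s y t P) (\<lambda>a. a > 0)"

text \<open>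
  The scalar \<open>alpha_RBB s y t P\<close> need not be positive when \<open>P\<close> is merely symmetric positive
  definite, since \<open>transpose P ** P ** A\<close> can have an indefinite symmetric part. With
  \<open>A = diag(1, 100)\<close>, \<open>s = (1, 1)\<close>, \<open>y = A *v s\<close>, \<open>t = 2\<close> and \<open>P\<close> the positive definite square
  root of the matrix with rows \<open>(12, -2)\<close> and \<open>(-2, 1)\<close>, the numerator is
  \<open>101 - 2 * 90 < 0\<close>, and the minimum over \<open>a > 0\<close> is not attained.
  A matrix function \<open>\<Phi>(A)\<close>, such as \<open>A\<close> or its square root, commutes with \<open>A\<close>, and this
  excludes the phenomenon.
\<close>

end

theory Submission
  imports Defs
begin

text \<open>
  Both squared norms are quadratic in \<open>a\<close>, so the objective is a parabola with leading
  coefficient \<open>s \<bullet> s + t * norm (P *v s)\<^sup>2\<close>, positive since \<open>s \<noteq> 0\<close> and \<open>t \<ge> 0\<close>. Completing the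
  square puts its vertex at \<open>alpha_RBB s y t P\<close>
  (\<open>RBB_objective_completed_square\<close>). Over the open half-line \<open>a > 0\<close> such a parabola has a
  minimiser exactly when its vertex is positive, and then only the vertex
  (\<open>is_arg_min_parabola_on_positives\<close>); this is the unconditional half of the theorem.

  What remains is the sign of the vertex. Since the gradient of the quadratic function is affine
  with linear part \<open>A\<close>, \<open>y = A *v s\<close>. If \<open>P\<close> commutes with \<open>A\<close>, then
  \<open>(P *v s) \<bullet> (P *v y) = (P *v s) \<bullet> (A *v (P *v s))\<close>, so the numerator of
  \<open>alpha_RBB\<close> is the value of the positive definite quadratic form of \<open>A\<close> at \<open>s\<close>, plus \<open>t\<close> times
  its value at \<open>P *v s\<close>.
\<close>

text \<open>
  The half-line is open, so when \<open>m \<le> 0\<close> the infimum is only approached as \<open>a\<close> tends to \<open>0\<close>.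
  This is why positivity of the vertex is part of the criterion.
\<close>

lemma is_arg_min_parabola_on_positives:
  fixes D m c \<beta> :: real
  assumes "D > 0" and f: "\<And>a. f a = D * (a - m)\<^sup>2 + c"
  shows "is_arg_min f (\<lambda>a. a > 0) \<beta> \<longleftrightarrow> \<beta> = m \<and> 0 < m"
proof
  assume min: "is_arg_min f (\<lambda>a. a > 0) \<beta>"
  then have pos: "\<beta> > 0" by (simp add: is_arg_min_def)
  have le: "(\<beta> - m)\<^sup>2 \<le> (a - m)\<^sup>2" if "a > 0" for a
    using min that \<open>D > 0\<close> by (force simp: is_arg_min_def f not_less)
  have "m > 0"
  proof (rule ccontr)
    assume "\<not> m > 0"
    \<comment> \<open>To the right of the vertex the parabola increases, so halving \<open>\<beta>\<close> would improve on it.\<close>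
    then have "(\<beta> / 2 - m)\<^sup>2 < (\<beta> - m)\<^sup>2"
      using pos by (intro power_strict_mono) auto
    with le[of "\<beta> / 2"] pos show False by simp
  qed
  with le[of m] show "\<beta> = m \<and> 0 < m" by simp
next
  assume "\<beta> = m \<and> 0 < m"
  then show "is_arg_min f (\<lambda>a. a > 0) \<beta>"
    using \<open>D > 0\<close> by (auto simp: is_arg_min_def f not_less)
qed

lemma inner_gram_matrix:
  fixes P :: "real ^ 'n ^ 'm"
  shows "u \<bullet> ((transpose P ** P) *v v) = (P *v u) \<bullet> (P *v v)"
proof -
  have "(P *v u) \<bullet> (P *v v) = ((P *v u) v* P) \<bullet> v"
    by (simp add: dot_lmul_matrix)
  also have "\<dots> = ((transpose P ** P) *v u) \<bullet> v"
    by (simp flip: transpose_matrix_vector add: matrix_vector_mul_assoc)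
  also have "\<dots> = (u v* (transpose P ** P)) \<bullet> v"
    by (simp flip: transpose_matrix_vector add: matrix_transpose_mul)
  finally show ?thesis by (simp add: dot_lmul_matrix)
qed

lemma RBB_objective_completed_square:
  fixes s y :: "real ^ 'n" and P :: "real ^ 'n ^ 'n"
  assumes "s \<noteq> 0" "t \<ge> 0"
  defines "D \<equiv> s \<bullet> s + t * (norm (P *v s))\<^sup>2"
  shows "D > 0"
    and "RBB_objective s y t P a =
      D * (a - alpha_RBB s y t P)\<^sup>2 + (RBB_objective s y t P 0 - D * (alpha_RBB s y t P)\<^sup>2)"
proof -
  show D: "D > 0"
    unfolding D_def using assms(1,2) by (intro add_pos_nonneg) auto
  have vertex: "D * alpha_RBB s y t P = s \<bullet> y + t * ((P *v s) \<bullet> (P *v y))"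
    using D by (simp add: D_def alpha_RBB_def inner_gram_matrix power2_norm_eq_inner)
  have norm_sq: "(norm (b *\<^sub>R u - v))\<^sup>2 = b\<^sup>2 * (u \<bullet> u) - 2 * b * (u \<bullet> v) + v \<bullet> v"
    for b and u v :: "real ^ 'n"
    unfolding power2_norm_eq_inner
    by (simp add: inner_diff_left inner_diff_right inner_commute power2_eq_square)
  have expand: "RBB_objective s y t P a =
      D * a\<^sup>2 - 2 * a * (s \<bullet> y + t * ((P *v s) \<bullet> (P *v y))) + RBB_objective s y t P 0"
    unfolding RBB_objective_def D_def norm_sq
    by (simp add: power2_norm_eq_inner algebra_simps)
  show "RBB_objective s y t P a =
      D * (a - alpha_RBB s y t P)\<^sup>2 + (RBB_objective s y t P 0 - D * (alpha_RBB s y t P)\<^sup>2)"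
    unfolding expand[folded vertex] by (simp add: power2_eq_square algebra_simps)
qed

lemma RBB_solution_iff:
  fixes s y :: "real ^ 'n"
  assumes "s \<noteq> 0" "t \<ge> 0"
  shows "RBB_solution s y t P \<beta> \<longleftrightarrow> \<beta> = alpha_RBB s y t P \<and> 0 < alpha_RBB s y t P"
  unfolding RBB_solution_def
  by (rule is_arg_min_parabola_on_positives[OF RBB_objective_completed_square[OF assms]])

lemma GDERIV_quad_fun:
  assumes "transpose A = A"
  shows "GDERIV (quad_fun A c) x :> A *v (x - c)"
proof -
  \<comment> \<open>The product rule yields two terms; the symmetry of \<open>A\<close> makes them equal.\<close>
  have sym: "u \<bullet> (A *v v) = v \<bullet> (A *v u)" for u v
    by (metis assms dot_lmul_matrix inner_commute transpose_matrix_vector)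
  have "((\<lambda>z. (1 / 2) * ((z - c) \<bullet> (A *v (z - c)))) has_derivative
      (\<lambda>h. (1 / 2) * ((x - c) \<bullet> (A *v h) + h \<bullet> (A *v (x - c))))) (at x)"
    by (auto intro!: derivative_eq_intros
        bounded_linear.has_derivative[OF matrix_vector_mul_bounded_linear])
  moreover have "(1 / 2) * ((x - c) \<bullet> (A *v h) + h \<bullet> (A *v (x - c))) = h \<bullet> (A *v (x - c))" for h
    using sym[of "x - c" h] by simp
  ultimately show ?thesis
    unfolding gderiv_def quad_fun_def by simp
qed

lemma GDERIV_unique:
  assumes "GDERIV f x :> d" "GDERIV f x :> e"
  shows "d = e"
proof -
  have "(\<lambda>h. h \<bullet> d) = (\<lambda>h. h \<bullet> e)"
    using assms unfolding gderiv_def by (rule has_derivative_unique)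
  then show ?thesis
    by (metis vector_eq_rdot inner_commute)
qed

text \<open>
  Commutation lets \<open>P\<close> pass through \<open>A\<close>, which turns the cross term \<open>(P *v s) \<bullet> (P *v (A *v s))\<close>
  into a value of the quadratic form of \<open>A\<close>; in general it can be negative.
\<close>

lemma alpha_RBB_pos_if_commute:
  assumes A: "sym_pos_def A" and comm: "P ** A = A ** P" and "s \<noteq> 0" "t \<ge> 0"
  shows "alpha_RBB s (A *v s) t P > 0"
proof -
  have form_nonneg: "v \<bullet> (A *v v) \<ge> 0" for v
    using A by (cases "v = 0") (auto simp: sym_pos_def_def less_imp_le)
  have "P *v (A *v s) = A *v (P *v s)"
    by (simp add: matrix_vector_mul_assoc comm)
  then have "s \<bullet> (A *v s) + t * ((P *v s) \<bullet> (P *v (A *v s))) > 0"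
    using A \<open>s \<noteq> 0\<close> \<open>t \<ge> 0\<close> form_nonneg
    by (intro add_pos_nonneg) (auto simp: sym_pos_def_def)
  moreover have "s \<bullet> s + t * ((P *v s) \<bullet> (P *v s)) > 0"
    using \<open>s \<noteq> 0\<close> \<open>t \<ge> 0\<close> by (intro add_pos_nonneg) auto
  ultimately show ?thesis
    by (simp add: alpha_RBB_def inner_gram_matrix)
qed

theorem theorem2p1:
  fixes A :: "real ^ 'n ^ 'n" and xstar :: "real ^ 'n"
    and x g :: "nat \<Rightarrow> real ^ 'n"
    and \<alpha> \<tau> :: "nat \<Rightarrow> real"
    and \<Phi> :: "nat \<Rightarrow> real ^ 'n ^ 'n \<Rightarrow> real ^ 'n ^ 'n"
    and k :: nat
    and s y :: "real ^ 'n"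
  assumes A: "sym_pos_def A"
    and grad: "\<And>j. GDERIV (quad_fun A xstar) (x j) :> g j"
    and descent: "\<And>j. x (Suc j) = x j - (1 / \<alpha> j) *\<^sub>R g j"
    and k: "k \<ge> 1"
    and s: "s = x k - x (k - 1)"
    and y: "y = g k - g (k - 1)"
    and s_nonzero: "s \<noteq> 0"
    and Phi: "sym_pos_def (\<Phi> k A)"
    and tau: "\<tau> k \<ge> 0"
  shows "(\<forall>\<beta>. RBB_solution s y (\<tau> k) (\<Phi> k A) \<beta> \<longleftrightarrow>
              \<beta> = alpha_RBB s y (\<tau> k) (\<Phi> k A) \<and> 0 < alpha_RBB s y (\<tau> k) (\<Phi> k A)) \<and>
         (\<Phi> k A ** A = A ** \<Phi> k A \<longrightarrow>
            (\<forall>\<beta>. RBB_solution s y (\<tau> k) (\<Phi> k A) \<beta> \<longleftrightarrow> \<beta> = alpha_RBB s y (\<tau> k) (\<Phi> k A)))"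
proof (intro conjI impI allI)
  fix \<beta>
  show "RBB_solution s y (\<tau> k) (\<Phi> k A) \<beta> \<longleftrightarrow>
      \<beta> = alpha_RBB s y (\<tau> k) (\<Phi> k A) \<and> 0 < alpha_RBB s y (\<tau> k) (\<Phi> k A)"
    by (rule RBB_solution_iff[OF s_nonzero tau])
next
  fix \<beta>
  assume comm: "\<Phi> k A ** A = A ** \<Phi> k A"
  have "g j = A *v (x j - xstar)" for j
    using grad GDERIV_quad_fun A GDERIV_unique by (metis sym_pos_def_def)
  then have "y = A *v s"
    by (simp add: y s matrix_vector_mult_diff_distrib)
  then have "alpha_RBB s y (\<tau> k) (\<Phi> k A) > 0"
    using alpha_RBB_pos_if_commute[OF A comm s_nonzero tau] by simp
  then show "RBB_solution s y (\<tau> k) (\<Phi> k A) \<beta> \<longleftrightarrow> \<beta> = alpha_RBB s y (\<tau> k) (\<Phi> k A)"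
    by (simp add: RBB_solution_iff[OF s_nonzero tau])
qed

end
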